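(* Let $d\ge 1$ and let $A_1,A_2:\mathbb{R}^d\to\mathbb{R}^d$ be positive expansive linear maps. Then $\mathcal{E}_{A_1}=\mathcal{E}_{A_2}$ if and only if there exists $t>0$ such that $A_1^t=A_2$.
   Context: $\mathbb{R}^d$ carries the Euclidean norm and $|\cdot|_d$ is $d$-dimensional Lebesgue measure; $B_r=\{\mathbf{x}\in\mathbb{R}^d:\|\mathbf{x}\|<r\}$. A linear map $A:\mathbb{R}^d\to\mathbb{R}^d$ is expansive if all its (complex) eigenvalues have absolute value greater than $1$. It is positive if it is self-adjoint and all its eigenvalues are positive. For an expansive linear map $A$, $\mathcal{E}_A$ is the family of all measurable sets $E\subset\mathbb{R}^d$ with $|E|_d>0$ for which the origin is a point of $A$-density, i.e. for all $r>0$, $$\lim_{j\to\infty}\frac{|E\cap A^{-j}B_r|_d}{|A^{-j}B_r|_d}=1.$$ Real powers: if $A=CJC^{-1}$ with $C$ invertible and $J$ diagonal with positive diagonal entries $\lambda_1,\dots,\lambda_d$, then $A^t=CJ^tC^{-1}$, where $J^t$ is the diagonal matrix with entries $\lambda_1^t,\dots,\lambda_d^t$. *)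

theory Defs
  imports "HOL-Analysis.Analysis"
begin

text \<open>
  Linear maps on \<open>d\<close>-dimensional Euclidean space are functions on \<^typ>\<open>real ^ 'n\<close> with
  \<open>d = CARD('n)\<close>, which is automatically at least 1. Their complex eigenvalues are those of the
  real standard matrix acting on \<^typ>\<open>complex ^ 'n\<close>.
\<close>

definition complex_eigenvalues :: "(real ^ 'n \<Rightarrow> real ^ 'n) \<Rightarrow> complex set" where
  "complex_eigenvalues A =
     {\<mu>. \<exists>v :: complex ^ 'n. v \<noteq> 0 \<and> map_matrix complex_of_real (matrix A) *v v = \<mu> *s v}"

definition expansive_map :: "(real ^ 'n \<Rightarrow> real ^ 'n) \<Rightarrow> bool" where
  "expansive_map A \<longleftrightarrow> linear A \<and> (\<forall>\<mu> \<in> complex_eigenvalues A. norm \<mu> > 1)"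

definition positive_map :: "(real ^ 'n \<Rightarrow> real ^ 'n) \<Rightarrow> bool" where
  "positive_map A \<longleftrightarrow> linear A \<and> adjoint A = A \<and>
     (\<forall>\<mu> \<in> complex_eigenvalues A. \<mu> \<in> \<real> \<and> Re \<mu> > 0)"

text \<open>
  Only \<open>E\<close> itself may have infinite measure, so its positivity is stated with \<^const>\<open>emeasure\<close>,
  whereas the quotients use the real-valued \<^const>\<open>measure\<close>. For the expansive maps considered,
  0 is not an eigenvalue, hence \<^term>\<open>inv A\<close> is a genuine inverse.
\<close>

definition density_point_sets :: "(real ^ 'n \<Rightarrow> real ^ 'n) \<Rightarrow> (real ^ 'n) set set" where
  "density_point_sets A =
     {E. E \<in> sets lebesgue \<and> emeasure lebesgue E > 0 \<and>
         (\<forall>r>0. (\<lambda>j. measure lebesgue (E \<inter> (inv A ^^ j) ` ball 0 r) /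
                     measure lebesgue ((inv A ^^ j) ` ball 0 r)) \<longlonglongrightarrow> 1)}"

definition diagonal_map :: "('n \<Rightarrow> real) \<Rightarrow> real ^ 'n \<Rightarrow> real ^ 'n" where
  "diagonal_map l x = (\<chi> i. l i * x $ i)"

definition is_powr_map :: "(real ^ 'n \<Rightarrow> real ^ 'n) \<Rightarrow> real \<Rightarrow> (real ^ 'n \<Rightarrow> real ^ 'n) \<Rightarrow> bool" where
  "is_powr_map A t B \<longleftrightarrow>
     (\<exists>(C :: real ^ 'n \<Rightarrow> real ^ 'n) (l :: 'n \<Rightarrow> real). linear C \<and> bij C \<and> (\<forall>i. l i > 0) \<and>
            A = C \<circ> diagonal_map l \<circ> inv C \<and>
            B = C \<circ> diagonal_map (\<lambda>i. l i powr t) \<circ> inv C)"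

definition powr_map :: "(real ^ 'n \<Rightarrow> real ^ 'n) \<Rightarrow> real \<Rightarrow> (real ^ 'n \<Rightarrow> real ^ 'n)" where
  "powr_map A t = (THE B. is_powr_map A t B)"

text \<open>
  The real power does not depend on the choice of the diagonalization, so \<^const>\<open>powr_map\<close> is
  well defined on every diagonalizable map with positive eigenvalues.
\<close>

lemma is_powr_map_unique:
  fixes A :: "real ^ 'n \<Rightarrow> real ^ 'n"
  assumes "is_powr_map A t B" "is_powr_map A t B'"
  shows "B = B'"
proof -
  obtain C :: "real ^ 'n \<Rightarrow> real ^ 'n" and l :: "'n \<Rightarrow> real" where
      C: "linear C" "bij C" "\<forall>i. l i > 0" "A = C \<circ> diagonal_map l \<circ> inv C"
      "B = C \<circ> diagonal_map (\<lambda>i. l i powr t) \<circ> inv C"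
    using assms(1) unfolding is_powr_map_def by blast
  obtain D :: "real ^ 'n \<Rightarrow> real ^ 'n" and k :: "'n \<Rightarrow> real" where
      D: "linear D" "bij D" "\<forall>i. k i > 0" "A = D \<circ> diagonal_map k \<circ> inv D"
      "B' = D \<circ> diagonal_map (\<lambda>i. k i powr t) \<circ> inv D"
    using assms(2) unfolding is_powr_map_def by blast
  have lin_diag: "linear (diagonal_map m)" for m :: "'n \<Rightarrow> real"
    by (rule linearI) (simp_all add: diagonal_map_def vec_eq_iff algebra_simps)
  have diag_axis: "diagonal_map m (axis j 1) = m j *\<^sub>R axis j 1" for m :: "'n \<Rightarrow> real" and j
    by (simp add: diagonal_map_def vec_eq_iff axis_def)
  have invC: "inv C (C x) = x" "C (inv C x) = x" for x
    using C(2) by (simp_all add: bij_is_inj bij_is_surj surj_f_inv_f)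
  have invD: "inv D (D x) = x" "D (inv D x) = x" for x
    using D(2) by (simp_all add: bij_is_inj bij_is_surj surj_f_inv_f)
  have lin_invD: "linear (inv D)"
  proof (rule linearI)
    fix x y :: "real ^ 'n" and c :: real
    show "inv D (x + y) = inv D x + inv D y"
      by (metis invD linear_add[OF D(1)])
    show "inv D (c *\<^sub>R x) = c *\<^sub>R inv D x"
      by (metis invD linear_cmul[OF D(1)])
  qed
  define M where "M = inv D \<circ> C"
  have lin_M: "linear M"
    unfolding M_def by (rule linear_compose[OF C(1) lin_invD])
  have "C (diagonal_map l (inv C (C x))) = D (diagonal_map k (inv D (C x)))" for x
    using fun_cong[OF trans[OF C(4)[symmetric] D(4)], of "C x"] by simp
  then have inter: "M (diagonal_map l x) = diagonal_map k (M x)" for x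
    by (simp add: M_def invC(1) invD(1))
  have "M (diagonal_map (\<lambda>i. l i powr t) (axis j 1)) =
        diagonal_map (\<lambda>i. k i powr t) (M (axis j 1))" for j
  proof -
    have eq: "l j * M (axis j 1) $ i = k i * M (axis j 1) $ i" for i
      using arg_cong[OF inter[of "axis j 1"], of "\<lambda>x. x $ i"]
      by (simp add: diag_axis linear_cmul[OF lin_M]) (simp add: diagonal_map_def)
    have "l j powr t * M (axis j 1) $ i = k i powr t * M (axis j 1) $ i" for i
      using eq[of i] by auto
    then show ?thesis
      by (simp add: diag_axis linear_cmul[OF lin_M]) (simp add: diagonal_map_def vec_eq_iff)
  qed
  then have "M \<circ> diagonal_map (\<lambda>i. l i powr t) = diagonal_map (\<lambda>i. k i powr t) \<circ> M"
    by (intro linear_eq_stdbasis linear_compose lin_M lin_diag) (auto simp: Basis_vec_def)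
  from fun_cong[OF this]
  have "inv D (C (diagonal_map (\<lambda>i. l i powr t) (inv C x))) =
        diagonal_map (\<lambda>i. k i powr t) (inv D (C (inv C x)))" for x
    by (simp add: M_def)
  then have "C (diagonal_map (\<lambda>i. l i powr t) (inv C x)) =
             D (diagonal_map (\<lambda>i. k i powr t) (inv D x))" for x
    by (metis invC(2) invD(2))
  then show ?thesis
    unfolding C(5) D(5) by (simp add: fun_eq_iff)
qed

lemma powr_map_eq: "is_powr_map A t B \<Longrightarrow> powr_map A t = B"
  unfolding powr_map_def using is_powr_map_unique by blast

end

theory Submission
  imports Defs
begin

text \<open>
  Diagonalize \<open>A1\<close> and \<open>A2\<close> in orthonormal bases \<open>e\<close>, \<open>f\<close> with eigenvalues \<open>l\<close>, \<open>m\<close>.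
  If \<open>A2 = A1\<^sup>t\<close>, every ellipsoid \<open>A2\<^sup>-\<^sup>j B\<^sub>r\<close> is squeezed between two consecutive \<open>A1\<^sup>-\<^sup>k B\<^sub>r\<close>, so both
  families of densities tend to 1 together.

  Conversely, let \<open>\<delta>1\<close>, \<open>\<delta>2\<close> be the factors by which \<open>A1\<^sup>-\<^sup>1\<close>, \<open>A2\<^sup>-\<^sup>1\<close> scale volume and
  \<open>t = ln \<delta>2 / ln \<delta>1\<close>. If \<open>e i\<close> and \<open>f j\<close> are not orthogonal, then \<open>A2\<^sup>-\<^sup>n B\<^sub>1\<close> has width at least of order
  \<open>(m j)\<^sup>-\<^sup>n\<close> in the direction \<open>e i\<close>, whereas \<open>A1\<^sup>-\<^sup>k B\<^sub>r\<close> has width of order \<open>(l i)\<^sup>-\<^sup>k\<close>. Were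
  \<open>(l i)\<^sup>t > m j\<close>, removing from each \<open>A2\<^sup>-\<^sup>n B\<^sub>1\<close> a fixed proportion lying far out in the direction
  \<open>e i\<close> would leave a set which still has density 1 along \<open>A1\<close> but not along \<open>A2\<close>. With the roles of
  \<open>A1\<close> and \<open>A2\<close> exchanged this gives \<open>m j = (l i)\<^sup>t\<close> unless \<open>e i\<close> and \<open>f j\<close> are orthogonal;
  expanding \<open>e i\<close> in the basis \<open>f\<close> yields \<open>A2 (e i) = (l i)\<^sup>t e i\<close>.
\<close>

section \<open>Orthonormal eigenbases\<close>

text \<open>A maximizer of the quadratic form of \<open>f\<close> on the unit sphere of
  \<open>S\<close> is an eigenvector, the maximum being its eigenvalue. Working in an invariant
  subspace lets eigenvectors be split off one by one.\<close>

lemma selfadjoint_has_eigenvector: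
  fixes f :: "'a::euclidean_space \<Rightarrow> 'a"
  assumes f: "linear f" and sa: "\<And>x y. f x \<bullet> y = x \<bullet> f y"
    and S: "subspace S" "f ` S \<subseteq> S" "S \<noteq> {0}"
  obtains v m where "v \<in> S" "norm v = 1" "f v = m *\<^sub>R v"
proof -
  let ?K = "S \<inter> sphere 0 1"
  have "compact ?K"
    by (simp add: S(1) closed_Int_compact closed_subspace)
  moreover have "?K \<noteq> {}"
  proof -
    obtain x where x: "x \<in> S" "x \<noteq> 0"
      using S(1,3) subspace_0 by blast
    then have "x /\<^sub>R norm x \<in> ?K"
      by (simp add: S(1) subspace_scale)
    then show ?thesis by blast
  qed
  moreover have "continuous_on ?K (\<lambda>x. f x \<bullet> x)"
    using f by (intro continuous_intros linear_continuous_on) (simp add: linear_conv_bounded_linear)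
  ultimately obtain v where v: "v \<in> ?K" and max: "\<And>x. x \<in> ?K \<Longrightarrow> f x \<bullet> x \<le> f v \<bullet> v"
    using continuous_attains_sup[of ?K "\<lambda>x. f x \<bullet> x"] by blast
  define m where "m = f v \<bullet> v"
  \<comment> \<open>Maximality of \<open>m\<close> makes the form of \<open>g\<close> nonnegative on
    \<open>S\<close>; what remains is to show \<open>g v = 0\<close>.\<close>
  define g where "g x = m *\<^sub>R x - f x" for x
  have g: "linear g"
    unfolding g_def by (intro linear_compose_sub linear_scale_self f) 
  have g_sa: "g x \<bullet> y = x \<bullet> g y" for x y
    by (simp add: g_def sa algebra_simps)
  have g_S: "g x \<in> S" if "x \<in> S" for x
    using that S unfolding g_def by (auto intro!: subspace_diff subspace_scale)
  have g_nonneg: "0 \<le> g x \<bullet> x" if "x \<in> S" for x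
  proof (cases "x = 0")
    case False
    have "x /\<^sub>R norm x \<in> ?K"
      using that False by (simp add: S(1) subspace_scale)
    from max[OF this] have "(f x \<bullet> x) / (norm x)\<^sup>2 \<le> m"
      by (simp add: m_def linear_cmul[OF f] power2_eq_square divide_simps)
    then have "f x \<bullet> x \<le> m * (norm x)\<^sup>2"
      using False by (simp add: field_simps)
    then show ?thesis
      by (simp add: g_def algebra_simps power2_norm_eq_inner)
  qed simp
  have vv: "v \<bullet> v = 1"
    using v by (simp add: norm_eq_1)
  have gv: "g v \<bullet> v = 0"
    by (simp add: g_def algebra_simps vv) (simp add: m_def)
  define u where "u = g v"
  have uS: "u \<in> S" using v g_S by (simp add: u_def)
  \<comment> \<open>the form of \<open>g\<close> is nonnegative on \<open>S\<close> and vanishes at \<open>v\<close>, so its first variation at \<open>v\<close> is zero\<close>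
  have quad: "2 * t * (u \<bullet> u) \<le> t\<^sup>2 * (g u \<bullet> u)" for t
  proof -
    have "v - t *\<^sub>R u \<in> S"
      using v uS S(1) by (simp add: subspace_diff subspace_scale)
    from g_nonneg[OF this]
    have "0 \<le> g v \<bullet> v - t * (g v \<bullet> u) - t * (g u \<bullet> v) + t\<^sup>2 * (g u \<bullet> u)"
      by (simp add: linear_diff[OF g] linear_cmul[OF g] algebra_simps power2_eq_square)
    moreover have "g u \<bullet> v = u \<bullet> u" by (simp add: g_sa u_def)
    ultimately show ?thesis using gv by (simp add: u_def)
  qed
  have "u = 0"
  proof (rule ccontr)
    assume "u \<noteq> 0"
    define a where "a = u \<bullet> u"
    define b where "b = g u \<bullet> u"
    have a: "a > 0" using \<open>u \<noteq> 0\<close> by (simp add: a_def)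
    have b: "b \<ge> 0" using g_nonneg uS by (simp add: b_def)
    \<comment> \<open>The summand 1 allows \<open>b = 0\<close> and gives \<open>t * b < a\<close>,
      against \<open>2 * a \<le> t * b\<close>.\<close>
    define t where "t = a / (b + 1)"
    have t: "t > 0" "t * (b + 1) = a" using a b by (simp_all add: t_def)
    have "t * (2 * a) \<le> t * (t * b)"
      using quad[of t] by (simp add: a_def b_def power2_eq_square algebra_simps)
    then have "2 * a \<le> t * b" using t(1) by simp
    then show False using t a by (simp add: algebra_simps)
  qed
  then have "f v = m *\<^sub>R v" by (simp add: u_def g_def)
  then show ?thesis using that v by auto
qed

text \<open>Induction on the dimension: once an eigenvector \<open>v\<close> is split off, its
  orthogonal complement in \<open>S\<close> is invariant again because \<open>f\<close> is
  self-adjoint.\<close>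

lemma selfadjoint_eigenbasis:
  fixes f :: "'a::euclidean_space \<Rightarrow> 'a"
  assumes f: "linear f" and sa: "\<And>x y. f x \<bullet> y = x \<bullet> f y"
    and "subspace S" "f ` S \<subseteq> S"
  shows "\<exists>B \<subseteq> S. pairwise orthogonal B \<and> (\<forall>b\<in>B. norm b = 1 \<and> (\<exists>m. f b = m *\<^sub>R b)) \<and> span B = S"
  using assms(3,4)
proof (induction "dim S" arbitrary: S rule: less_induct)
  case less
  note S = less.prems
  show ?case
  proof (cases "S = {0}")
    case True
    then show ?thesis by (intro exI[of _ "{}"]) auto
  next
    case False
    obtain v m where v: "v \<in> S" "norm v = 1" "f v = m *\<^sub>R v"
      using selfadjoint_has_eigenvector[OF f sa S False] by blast
    have vv: "v \<bullet> v = 1" using v(2) by (simp add: norm_eq_1)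
    let ?T = "S \<inter> {x. v \<bullet> x = 0}"
    have T: "subspace ?T" by (intro subspace_inter subspace_hyperplane S)
    have fT: "f ` ?T \<subseteq> ?T"
    proof safe
      fix x assume x: "x \<in> S" "v \<bullet> x = 0"
      show "f x \<in> S" using S x by blast
      show "v \<bullet> f x = 0" using x by (simp flip: sa add: v)
    qed
    have "v \<notin> ?T" using vv by simp
    then have "?T \<subset> S" using v by blast
    then have "dim ?T < dim S"
      using T S(1) by (intro dim_psubset) (simp add: span_eq_iff[THEN iffD2])
    from less.hyps[OF this T fT] obtain B where B: "B \<subseteq> ?T" "pairwise orthogonal B"
      "\<forall>b\<in>B. norm b = 1 \<and> (\<exists>m. f b = m *\<^sub>R b)" "span B = ?T" by blast
    have "S \<subseteq> span (insert v B)"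
    proof
      fix x assume x: "x \<in> S"
      have "x - (v \<bullet> x) *\<^sub>R v \<in> ?T"
        using x v S by (simp add: subspace_diff subspace_scale inner_diff_right vv)
      then have "x - (v \<bullet> x) *\<^sub>R v \<in> span B" using B by simp
      then show "x \<in> span (insert v B)" unfolding span_insert by blast
    qed
    moreover have "span (insert v B) \<subseteq> S"
      using B(1) v(1) S(1) by (intro span_minimal) auto
    moreover have "pairwise orthogonal (insert v B)"
      using B by (auto simp: pairwise_insert orthogonal_def inner_commute)
    ultimately show ?thesis using B v
      by (intro exI[of _ "insert v B"]) auto
  qed
qed

text \<open>Indexing by \<open>'n\<close> makes the number of orthonormal vectors equal to the
  dimension, so \<open>e\<close> is a basis, and allows repeated eigenvalues. The bound
  \<open>l i > 1\<close> records positivity and expansiveness together.\<close>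

definition eigenframe :: "(real ^ 'n \<Rightarrow> real ^ 'n) \<Rightarrow> ('n \<Rightarrow> real ^ 'n) \<Rightarrow> ('n \<Rightarrow> real) \<Rightarrow> bool" where
  "eigenframe A e l \<longleftrightarrow> linear A \<and> (\<forall>i j. e i \<bullet> e j = (if i = j then 1 else 0)) \<and>
     (\<forall>i. l i > 1 \<and> A (e i) = l i *\<^sub>R e i)"

text \<open>Positivity and expansiveness speak of complex eigenvalues, whereas the spectral argument
  yields real ones. Embedding \<open>v\<close> coordinatewise works since the matrix is
  real.\<close>

lemma real_eigenvalue_in_complex_eigenvalues:
  fixes A :: "real ^ 'n \<Rightarrow> real ^ 'n"
  assumes "linear A" "v \<noteq> 0" "A v = m *\<^sub>R v"
  shows "complex_of_real m \<in> complex_eigenvalues A"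
proof -
  let ?v = "(\<chi> i. complex_of_real (v $ i)) :: complex ^ 'n"
  have "?v \<noteq> 0" using assms(2) by (simp add: vec_eq_iff)
  moreover have "map_matrix complex_of_real (matrix A) *v ?v = complex_of_real m *s ?v"
  proof (simp add: vec_eq_iff matrix_vector_mult_def, intro allI)
    fix i
    have "(\<Sum>j\<in>UNIV. matrix A $ i $ j * v $ j) = m * v $ i"
      using fun_cong[OF matrix_vector_mul(2)[OF assms(1)], of v] assms(3)
      by (simp add: vec_eq_iff matrix_vector_mult_def)
    then show "(\<Sum>j\<in>UNIV. complex_of_real (matrix A $ i $ j) * complex_of_real (v $ j)) =
        complex_of_real m * complex_of_real (v $ i)"
      by (metis (no_types, lifting) of_real_mult of_real_sum sum.cong)
  qed
  ultimately show ?thesis unfolding complex_eigenvalues_def by blast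
qed

lemma positive_expansive_eigenframe:
  fixes A :: "real ^ 'n \<Rightarrow> real ^ 'n"
  assumes "positive_map A" "expansive_map A"
  obtains e l where "eigenframe A e l"
proof -
  have A: "linear A" "adjoint A = A" using assms by (auto simp: positive_map_def)
  have sa: "A x \<bullet> y = x \<bullet> A y" for x y
    using adjoint_works[OF A(1), of x y] A(2) by (simp add: inner_commute)
  obtain B where B: "pairwise orthogonal B"
     "\<forall>b\<in>B. norm b = 1 \<and> (\<exists>m. A b = m *\<^sub>R b)" "span B = UNIV"
    using selfadjoint_eigenbasis[OF A(1) sa subspace_UNIV] by auto
  have "independent B"
    using B by (intro pairwise_orthogonal_independent) auto
  then have "finite B" "card B = CARD('n)"
    using B(3) independent_bound dim_eq_card[of B "UNIV :: (real ^ 'n) set"]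
    by (auto simp: dim_UNIV)
  then obtain e :: "'n \<Rightarrow> real ^ 'n" where e: "bij_betw e UNIV B"
    using finite_same_card_bij[of "UNIV :: 'n set" B] by auto
  then have eB: "e i \<in> B" for i by (auto simp: bij_betw_def)
  then have "\<forall>i. \<exists>m. A (e i) = m *\<^sub>R e i" using B by blast
  then obtain l where l: "\<And>i. A (e i) = l i *\<^sub>R e i" by metis
  \<comment> \<open>Positivity makes the eigenvalue equal to its modulus, which expansiveness puts
    above 1.\<close>
  have "l i > 1" for i
  proof -
    have "complex_of_real (l i) \<in> complex_eigenvalues A"
      using eB[of i] B(2) by (intro real_eigenvalue_in_complex_eigenvalues[OF A(1) _ l]) force
    then have "norm (complex_of_real (l i)) > 1" "Re (complex_of_real (l i)) > 0"
      using assms unfolding positive_map_def expansive_map_def by blast+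
    then show ?thesis by simp
  qed
  moreover have "e i \<bullet> e j = (if i = j then 1 else 0)" for i j
  proof -
    have "e i \<noteq> e j" if "i \<noteq> j" using e that by (auto simp: bij_betw_def dest: injD)
    then show ?thesis using eB B by (auto simp: pairwise_def orthogonal_def norm_eq_1)
  qed
  ultimately have "eigenframe A e l" by (simp add: eigenframe_def A l)
  then show ?thesis using that by blast
qed

section \<open>Real powers in an eigenframe\<close>

text \<open>Arbitrary real exponents put the ellipsoids of \<open>A\<close> and of its powers into
  one family, in which \<open>inv A ^^ j\<close> has exponent \<open>- real j\<close>.\<close>

definition frame_powr :: "('n \<Rightarrow> real ^ 'n) \<Rightarrow> ('n \<Rightarrow> real) \<Rightarrow> real \<Rightarrow> real ^ 'n \<Rightarrow> real ^ 'n" where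
  "frame_powr e l s x = (\<Sum>i\<in>UNIV. (l i powr s * (x \<bullet> e i)) *\<^sub>R e i)"

lemma linear_frame_powr: "linear (frame_powr e l s)"
  by (rule linearI)
    (simp_all add: frame_powr_def inner_add_left algebra_simps sum.distrib scaleR_sum_right)

lemma frame_powr_eigen:
  assumes "eigenframe A e l"
  shows "frame_powr e l s (e i) = l i powr s *\<^sub>R e i"
proof -
  have "frame_powr e l s (e i) = (\<Sum>j\<in>UNIV. if i = j then l i powr s *\<^sub>R e i else 0)"
    unfolding frame_powr_def using assms by (intro sum.cong) (auto simp: eigenframe_def)
  then show ?thesis by simp
qed

lemma inner_frame_powr:
  assumes "eigenframe A e l"
  shows "frame_powr e l s x \<bullet> e i = l i powr s * (x \<bullet> e i)"
proof -
  have "frame_powr e l s x \<bullet> e i = (\<Sum>j\<in>UNIV. if i = j then l i powr s * (x \<bullet> e i) else 0)"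
    unfolding frame_powr_def inner_sum_left using assms by (intro sum.cong) (auto simp: eigenframe_def)
  then show ?thesis by simp
qed

text \<open>The difference \<open>z\<close> of the two sides is orthogonal to every
  \<open>e j\<close>, hence to their span, which is the whole space by counting dimensions.\<close>

lemma frame_expansion:
  assumes "eigenframe A e l"
  shows "(\<Sum>i\<in>UNIV. (x \<bullet> e i) *\<^sub>R e i) = x"
proof -
  have e: "e i \<bullet> e j = (if i = j then 1 else 0)" for i j
    using assms by (simp add: eigenframe_def)
  have inj: "inj e"
    by (rule injI) (metis e zero_neq_one)
  have "pairwise orthogonal (range e)"
    using e by (auto simp: pairwise_def orthogonal_def)
  moreover have "0 \<notin> range e"
    using e by (metis (full_types) imageE inner_zero_left zero_neq_one)
  ultimately have ind: "independent (range e)"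
    by (rule pairwise_orthogonal_independent)
  have "card (range e) = dim (UNIV :: (real ^ 'a) set)"
    using inj by (simp add: card_image)
  then have sp: "span (range e) = UNIV"
    using ind card_eq_dim[of "range e" UNIV] by auto
  define z where "z = (\<Sum>i\<in>UNIV. (x \<bullet> e i) *\<^sub>R e i) - x"
  have ze: "z \<bullet> e j = 0" for j
  proof -
    have "(\<Sum>i\<in>UNIV. (x \<bullet> e i) *\<^sub>R e i) \<bullet> e j = (\<Sum>i\<in>UNIV. if i = j then x \<bullet> e j else 0)"
      unfolding inner_sum_left by (intro sum.cong) (simp_all add: e)
    then show ?thesis by (simp add: z_def inner_diff_left)
  qed
  have "z \<bullet> y = 0" if "y \<in> span (range e)" for y
    using that by (induction rule: span_induct_alt) (auto simp: inner_add_right ze)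
  then have "z \<bullet> z = 0" by (simp add: sp)
  then show ?thesis by (simp add: z_def)
qed

lemma frame_eqI:
  assumes "eigenframe A e l" "\<And>i. x \<bullet> e i = y \<bullet> e i"
  shows "x = y"
  by (subst (1 2) frame_expansion[OF assms(1), symmetric]) (simp only: assms(2))

lemma frame_powr_frame_powr:
  assumes "eigenframe A e l"
  shows "frame_powr e l s (frame_powr e l t x) = frame_powr e l (s + t) x"
  by (rule frame_eqI[OF assms]) (simp add: inner_frame_powr[OF assms] powr_add)

lemma frame_powr_0:
  assumes "eigenframe A e l"
  shows "frame_powr e l 0 x = x"
proof (rule frame_eqI[OF assms])
  fix i
  have "l i \<noteq> 0" using assms by (auto simp: eigenframe_def dest: spec[of _ i])
  then show "frame_powr e l 0 x \<bullet> e i = x \<bullet> e i"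
    by (simp add: inner_frame_powr[OF assms])
qed

lemma frame_powr_1:
  assumes "eigenframe A e l"
  shows "frame_powr e l 1 = A"
proof
  fix x
  have A: "linear A" "\<And>i. A (e i) = l i *\<^sub>R e i" "\<And>i. l i > 1"
    using assms by (auto simp: eigenframe_def)
  have "A x = A (\<Sum>i\<in>UNIV. (x \<bullet> e i) *\<^sub>R e i)"
    by (simp add: frame_expansion[OF assms])
  also have "\<dots> = (\<Sum>i\<in>UNIV. (l i powr 1 * (x \<bullet> e i)) *\<^sub>R e i)"
    unfolding linear_sum[OF A(1)] 
  proof (intro sum.cong refl)
    fix i show "A ((x \<bullet> e i) *\<^sub>R e i) = (l i powr 1 * (x \<bullet> e i)) *\<^sub>R e i"
      using A(3)[of i] by (simp add: linear_cmul[OF A(1)] A(2) mult.commute)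
  qed
  finally show "frame_powr e l 1 x = A x" by (simp add: frame_powr_def)
qed

lemma inv_frame_powr:
  assumes "eigenframe A e l"
  shows "inv (frame_powr e l s) = frame_powr e l (- s)"
  by (rule inv_unique_comp)
    (simp_all add: frame_powr_frame_powr[OF assms] frame_powr_0[OF assms] fun_eq_iff)

lemma funpow_frame_powr:
  assumes "eigenframe A e l"
  shows "frame_powr e l s ^^ j = frame_powr e l (s * real j)"
  by (induction j)
    (simp_all add: frame_powr_frame_powr[OF assms] frame_powr_0[OF assms] fun_eq_iff algebra_simps)

lemma inv_eq_frame_powr: "eigenframe A e l \<Longrightarrow> inv A = frame_powr e l (-1)"
  using inv_frame_powr[of A e l 1] by (simp add: frame_powr_1)

lemma inv_power_eq_frame_powr: "eigenframe A e l \<Longrightarrow> inv A ^^ j = frame_powr e l (- real j)"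
  using funpow_frame_powr[where s = "-1"] by (simp add: inv_eq_frame_powr)

lemma frame_norm:
  assumes "eigenframe A e l"
  shows "(norm x)\<^sup>2 = (\<Sum>i\<in>UNIV. (x \<bullet> e i)\<^sup>2)"
proof -
  have "(norm x)\<^sup>2 = x \<bullet> (\<Sum>i\<in>UNIV. (x \<bullet> e i) *\<^sub>R e i)"
    by (simp only: frame_expansion[OF assms] power2_norm_eq_inner)
  then show ?thesis by (simp add: inner_sum_right power2_eq_square)
qed

lemma norm_frame_powr_le:
  assumes "eigenframe A e l" "q \<ge> 0" "\<And>i. l i powr s \<le> q"
  shows "norm (frame_powr e l s x) \<le> q * norm x"
proof (rule power2_le_imp_le)
  have "(norm (frame_powr e l s x))\<^sup>2 = (\<Sum>i\<in>UNIV. (l i powr s)\<^sup>2 * (x \<bullet> e i)\<^sup>2)"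
    by (simp add: frame_norm[OF assms(1)] inner_frame_powr[OF assms(1)] power_mult_distrib)
  also have "\<dots> \<le> (\<Sum>i\<in>UNIV. q\<^sup>2 * (x \<bullet> e i)\<^sup>2)"
    using assms(3) by (intro sum_mono mult_right_mono power_mono) auto
  also have "\<dots> = (q * norm x)\<^sup>2"
    by (simp add: frame_norm[OF assms(1)] sum_distrib_left power_mult_distrib)
  finally show "(norm (frame_powr e l s x))\<^sup>2 \<le> (q * norm x)\<^sup>2" .
qed (use assms(2) in simp)

text \<open>The power \<open>s\<close> is the power \<open>t\<close> after the power
  \<open>s - t\<close>, and the latter does not increase norms because \<open>l i > 1\<close> and
  \<open>s - t \<le> 0\<close>.\<close>

lemma frame_powr_ball_subset:
  assumes "eigenframe A e l" "s \<le> t"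
  shows "frame_powr e l s ` ball 0 r \<subseteq> frame_powr e l t ` ball 0 r"
proof
  fix y assume "y \<in> frame_powr e l s ` ball 0 r"
  then obtain x where x: "norm x < r" "y = frame_powr e l s x" by auto
  have "l i powr (s - t) \<le> 1" for i
  proof -
    have "l i > 1" using assms(1) by (simp add: eigenframe_def)
    then show ?thesis using powr_mono[of "s - t" 0 "l i"] assms(2) by simp
  qed
  then have "norm (frame_powr e l (s - t) x) \<le> norm x"
    using norm_frame_powr_le[OF assms(1), of 1] by simp
  moreover have "y = frame_powr e l t (frame_powr e l (s - t) x)"
    by (simp add: x frame_powr_frame_powr[OF assms(1)])
  ultimately show "y \<in> frame_powr e l t ` ball 0 r" using x by auto
qed

lemma frame_powr_self_adjoint:
  assumes "eigenframe A e l"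
  shows "frame_powr e l s x \<bullet> y = x \<bullet> frame_powr e l s y"
proof -
  have "frame_powr e l s x \<bullet> y = (\<Sum>i\<in>UNIV. l i powr s * (x \<bullet> e i) * (y \<bullet> e i))"
    unfolding frame_powr_def inner_sum_left by (intro sum.cong) (simp_all add: inner_commute)
  also have "\<dots> = x \<bullet> frame_powr e l s y"
    unfolding frame_powr_def inner_sum_right by (intro sum.cong) simp_all
  finally show ?thesis .
qed

lemma is_powr_map_frame_powr:
  assumes "eigenframe A e l"
  shows "is_powr_map A t (frame_powr e l t)"
proof -
  \<comment> \<open>\<open>C\<close> maps the standard basis to the frame and its inverse
    \<open>D\<close> reads off frame coordinates, so one \<open>C\<close> diagonalizes all
    powers.\<close>
  define C :: "real ^ 'a \<Rightarrow> real ^ 'a" where "C x = (\<Sum>i\<in>UNIV. (x $ i) *\<^sub>R e i)" for x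
  define D :: "real ^ 'a \<Rightarrow> real ^ 'a" where "D x = (\<chi> i. x \<bullet> e i)" for x
  have C: "linear C"
    by (rule linearI) (simp_all add: C_def algebra_simps sum.distrib scaleR_sum_right)
  have CD: "C (D x) = x" for x
    by (simp add: C_def D_def frame_expansion[OF assms])
  have "surj C" by (metis CD surjI)
  then have "inj C" by (rule linear_surjective_imp_injective[OF C]) simp
  have bij: "bij C" using \<open>surj C\<close> \<open>inj C\<close> by (simp add: bij_def)
  have inv: "inv C = D" 
    using CD \<open>inj C\<close> by (metis inv_f_f ext)
  have l: "l i > 0" for i using assms by (auto simp: eigenframe_def intro: less_trans[of 0 1])
  have powr: "frame_powr e l s = C \<circ> diagonal_map (\<lambda>i. l i powr s) \<circ> inv C" for s
    by (auto simp: inv frame_powr_def C_def D_def diagonal_map_def)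
  have "A = C \<circ> diagonal_map l \<circ> inv C"
    using powr[of 1] l by (simp add: frame_powr_1[OF assms] less_imp_le)
  with powr C bij l show ?thesis unfolding is_powr_map_def by blast
qed

section \<open>Volume scaling\<close>

lemma nn_integral_lborel_translate:
  fixes f :: "'a::euclidean_space \<Rightarrow> ennreal"
  assumes [measurable]: "f \<in> borel_measurable borel"
  shows "(\<integral>\<^sup>+x. f (c + x) \<partial>lborel) = (\<integral>\<^sup>+x. f x \<partial>lborel)"
proof -
  have "(\<integral>\<^sup>+x. f x \<partial>lborel) = (\<integral>\<^sup>+x. f x \<partial>distr lborel borel ((+) c))"
    by (simp add: lborel_distr_plus)
  also have "\<dots> = (\<integral>\<^sup>+x. f (c + x) \<partial>lborel)"
    by (subst nn_integral_distr) auto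
  finally show ?thesis ..
qed

text \<open>
  Uniqueness of Haar measure by Fubini, for the measure pushed forward by \<open>A\<close>. The library theorem
  \<open>measure_linear_image\<close> does not apply, since it asks for a wellordered index type.
\<close>

lemma emeasure_linear_image_proportional:
  fixes A T :: "'a::euclidean_space \<Rightarrow> 'a"
  assumes A: "linear A" and AT: "\<And>x. A (T x) = x" and TA: "\<And>x. T (A x) = x"
    and S [measurable]: "S \<in> sets borel"
  shows "emeasure lborel (T ` S) * emeasure lborel (ball 0 1 :: 'a set) =
         emeasure lborel S * emeasure lborel (T ` ball 0 1)"
proof -
  let ?B = "ball 0 1 :: 'a set"
  have [measurable]: "A \<in> borel_measurable borel"
    by (intro borel_measurable_continuous_onI linear_continuous_on) 
      (use A in \<open>simp add: linear_conv_bounded_linear\<close>)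
  have [measurable]: "?B \<in> sets borel" by simp
  have image: "emeasure lborel (T ` X) = (\<integral>\<^sup>+z. indicator X (A z) \<partial>lborel)"
    if [measurable]: "X \<in> sets borel" for X
  proof -
    have "T ` X = A -` X"
      by (intro set_eqI iffI) (use AT in force, metis TA imageI vimageD)
    moreover have "A -` X \<in> sets borel"
      using measurable_sets[of A borel borel X] by simp
    ultimately have "emeasure lborel (T ` X) = (\<integral>\<^sup>+z. indicator (A -` X) z \<partial>lborel)" by simp
    then show ?thesis by (simp add: indicator_def)
  qed
  have "emeasure lborel (T ` S) * emeasure lborel ?B =
      (\<integral>\<^sup>+y. (\<integral>\<^sup>+z. indicator S (A z) \<partial>lborel) * indicator ?B y \<partial>lborel)"
    unfolding image[OF S] by (subst nn_integral_cmult) (simp_all add: borel_measurable_indicator)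
  \<comment> \<open>For fixed \<open>y\<close>, translating \<open>z\<close> by \<open>T y\<close>
    turns \<open>A z\<close> into \<open>y + A z\<close>. After exchanging the integrals,
    translating \<open>y\<close> by \<open>A z\<close> moves this shift from \<open>S\<close> onto
    the ball.\<close>
  also have "\<dots> = (\<integral>\<^sup>+y. (\<integral>\<^sup>+z. indicator S (y + A z) * indicator ?B y \<partial>lborel) \<partial>lborel)"
  proof (rule nn_integral_cong)
    fix y
    have "(\<integral>\<^sup>+z. indicator S (A z) \<partial>lborel) = ((\<integral>\<^sup>+z. indicator S (A (T y + z)) \<partial>lborel) :: ennreal)"
      by (rule nn_integral_lborel_translate[symmetric]) measurable
    then show "(\<integral>\<^sup>+z. indicator S (A z) \<partial>lborel) * indicator ?B y =
        (\<integral>\<^sup>+z. indicator S (y + A z) * indicator ?B y \<partial>lborel)"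
      by (subst nn_integral_multc) (simp_all add: linear_add[OF A] AT)
  qed
  also have "\<dots> = (\<integral>\<^sup>+z. (\<integral>\<^sup>+y. indicator S (y + A z) * indicator ?B y \<partial>lborel) \<partial>lborel)"
    by (rule lborel_pair.Fubini') measurable
  also have "\<dots> = (\<integral>\<^sup>+z. (\<integral>\<^sup>+y. indicator S y * indicator ?B (y - A z) \<partial>lborel) \<partial>lborel)"
  proof (rule nn_integral_cong)
    fix z
    show "(\<integral>\<^sup>+y. indicator S (y + A z) * indicator ?B y \<partial>lborel) =
        ((\<integral>\<^sup>+y. indicator S y * indicator ?B (y - A z) \<partial>lborel) :: ennreal)"
      by (subst nn_integral_lborel_translate[of "\<lambda>y. indicator S y * indicator ?B (y - A z)" "A z", symmetric])
        (simp_all add: add.commute)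
  qed
  also have "\<dots> = (\<integral>\<^sup>+y. (\<integral>\<^sup>+z. indicator S y * indicator ?B (y - A z) \<partial>lborel) \<partial>lborel)"
    by (rule lborel_pair.Fubini'[symmetric]) measurable
  also have "\<dots> = (\<integral>\<^sup>+y. indicator S y * (\<integral>\<^sup>+z. indicator ?B (A z) \<partial>lborel) \<partial>lborel)"
  proof (rule nn_integral_cong)
    fix y
    \<comment> \<open>The ball is symmetric, so \<open>y - A z\<close> may be negated; the shift by
      \<open>- T y\<close> then disappears by translation invariance.\<close>
    have "indicator ?B (y - A z) = (indicator ?B (A (- T y + z)) :: ennreal)" for z
      by (simp add: linear_add[OF A] linear_diff[OF A] linear_neg[OF A] AT indicator_def dist_norm norm_minus_commute)
    then have "(\<integral>\<^sup>+z. indicator ?B (y - A z) \<partial>lborel) = ((\<integral>\<^sup>+z. indicator ?B (A (- T y + z)) \<partial>lborel) :: ennreal)"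
      by simp
    also have "\<dots> = (\<integral>\<^sup>+z. indicator ?B (A z) \<partial>lborel)"
      by (rule nn_integral_lborel_translate[of "\<lambda>z. indicator ?B (A z)"]) measurable
    finally show "(\<integral>\<^sup>+z. indicator S y * indicator ?B (y - A z) \<partial>lborel) =
        indicator S y * ((\<integral>\<^sup>+z. indicator ?B (A z) \<partial>lborel) :: ennreal)"
      by (subst nn_integral_cmult) (simp_all add: borel_measurable_indicator)
  qed
  also have "\<dots> = emeasure lborel S * emeasure lborel (T ` ?B)"
    unfolding image[OF borel_open[OF open_ball]] by (subst nn_integral_multc) (simp_all add: borel_measurable_indicator)
  finally show ?thesis .
qed

text \<open>For an invertible linear map this is the reciprocal of the modulus of the determinant,
  read off from the unit ball.\<close>

definition contraction_ratio :: "(real ^ 'n \<Rightarrow> real ^ 'n) \<Rightarrow> real" where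
  "contraction_ratio A = measure lebesgue (inv A ` ball 0 1) / measure lebesgue (ball (0 :: real ^ 'n) 1)"

lemma measure_ball:
  fixes a :: "real ^ 'n"
  assumes "r \<ge> 0"
  shows "measure lebesgue (ball a r) = r ^ CARD('n) * measure lebesgue (ball (0 :: real ^ 'n) 1)"
  using content_ball_conv_unit_ball[OF assms, of a] by (simp add: measure_completion)

lemma measure_ball_pos: "r > 0 \<Longrightarrow> measure lebesgue (ball (a :: real ^ 'n) r) > 0"
  using content_ball_pos[of r a] by (simp add: measure_completion)

lemma frame_powr_inverse:
  assumes "eigenframe A e l"
  shows "frame_powr e l s (frame_powr e l (- s) x) = x"
  by (simp add: frame_powr_frame_powr[OF assms] frame_powr_0[OF assms])

lemma open_frame_powr_image:
  assumes "eigenframe A e l" "open S"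
  shows "open (frame_powr e l s ` S)"
proof (rule open_surjective_linear_image[OF assms(2) linear_frame_powr])
  show "surj (frame_powr e l s)" using frame_powr_inverse[OF assms(1)] by (metis surjI)
qed

lemma measure_inv_image:
  fixes A :: "real ^ 'n \<Rightarrow> real ^ 'n"
  assumes "eigenframe A e l" "open S"
  shows "measure lebesgue (inv A ` S) = contraction_ratio A * measure lebesgue S"
proof -
  let ?B = "ball 0 1 :: (real ^ 'n) set"
  have inv: "A (inv A x) = x" "inv A (A x) = x" for x
    using frame_powr_inverse[OF assms(1), of 1 x] frame_powr_inverse[OF assms(1), of "-1" x]
    by (simp_all add: inv_eq_frame_powr[OF assms(1)] frame_powr_1[OF assms(1)])
  have op: "open (inv A ` X)" if "open X" for X
    using that by (simp add: inv_eq_frame_powr[OF assms(1)] open_frame_powr_image[OF assms(1)])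
  have "linear A" using assms(1) by (simp add: eigenframe_def)
  from emeasure_linear_image_proportional[OF this inv, of S]
  have "measure lborel (inv A ` S) * measure lborel ?B = measure lborel S * measure lborel (inv A ` ?B)"
    using assms(2) by (simp add: measure_def flip: enn2real_mult)
  then show ?thesis
    using measure_ball_pos[of 1 "0 :: real ^ 'n"] op assms(2)
    by (simp add: contraction_ratio_def measure_completion divide_simps mult_ac)
qed

lemma measure_inv_power_image:
  fixes A :: "real ^ 'n \<Rightarrow> real ^ 'n"
  assumes "eigenframe A e l" "open S"
  shows "measure lebesgue ((inv A ^^ j) ` S) = contraction_ratio A ^ j * measure lebesgue S"
proof (induction j)
  case (Suc j)
  have "(inv A ^^ Suc j) ` S = inv A ` (inv A ^^ j) ` S" by (simp add: image_comp)
  moreover have "open ((inv A ^^ j) ` S)"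
    by (simp add: inv_power_eq_frame_powr[OF assms(1)] open_frame_powr_image[OF assms(1)] assms(2))
  ultimately show ?case using Suc by (simp add: measure_inv_image[OF assms(1)])
qed simp

lemma lmeasurable_frame_powr_ball:
  assumes "eigenframe A e l"
  shows "frame_powr e l s ` ball a r \<in> lmeasurable"
proof (intro lmeasurable_open open_frame_powr_image[OF assms] open_ball bounded_linear_image)
  show "bounded_linear (frame_powr e l s)"
    using linear_frame_powr by (simp add: linear_conv_bounded_linear)
qed simp

text \<open>Positive because the unit ball is itself an image under \<open>inv A\<close>; below 1
  because \<open>inv A\<close> maps the unit ball into a smaller concentric ball.\<close>

lemma contraction_ratio_bounds:
  fixes A :: "real ^ 'n \<Rightarrow> real ^ 'n"
  assumes "eigenframe A e l"
  shows "0 < contraction_ratio A" "contraction_ratio A < 1"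
proof -
  let ?B = "ball 0 1 :: (real ^ 'n) set"
  have V: "measure lebesgue ?B > 0" by (simp add: measure_ball_pos)
  have "inv A (A x) = x" for x
    using frame_powr_inverse[OF assms, of "-1" x]
    by (simp add: inv_eq_frame_powr[OF assms] frame_powr_1[OF assms])
  then have "inv A ` A ` ?B = ?B" by (simp add: image_image)
  moreover have "open (A ` ?B)"
    using open_frame_powr_image[OF assms, of ?B 1] by (simp add: frame_powr_1[OF assms])
  ultimately have "measure lebesgue ?B = contraction_ratio A * measure lebesgue (A ` ?B)"
    using measure_inv_image[OF assms, of "A ` ?B"] by simp
  then have "contraction_ratio A \<noteq> 0" using V by auto
  then show "0 < contraction_ratio A" by (simp add: contraction_ratio_def order_less_le)
  \<comment> \<open>\<open>q\<close> is the operator norm of \<open>inv A\<close>; a maximum over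
    finitely many indices is attained, which gives \<open>q < 1\<close>.\<close>
  define q where "q = Max (range (\<lambda>i. l i powr -1))"
  have le: "l i powr -1 \<le> q" for i unfolding q_def by (intro Max_ge) auto
  have "q \<in> range (\<lambda>i. l i powr -1)" unfolding q_def by (intro Max_in) auto
  then obtain i where i: "q = l i powr -1" by auto
  have "l i > 1" using assms by (simp add: eigenframe_def)
  then have q: "0 < q" "q < 1" by (auto simp: i powr_minus divide_simps)
  have "inv A ` ball 0 1 \<subseteq> ball 0 q"
  proof (clarsimp simp: inv_eq_frame_powr[OF assms])
    fix x :: "real ^ 'n" assume "norm x < 1"
    then have "q * norm x < q" using q by simp
    moreover have "norm (frame_powr e l (- 1) x) \<le> q * norm x"
      using q le by (intro norm_frame_powr_le[OF assms]) auto
    ultimately show "norm (frame_powr e l (- 1) x) < q" by linarith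
  qed
  then have "measure lebesgue (inv A ` ball 0 1) \<le> measure lebesgue (ball (0 :: real ^ 'n) q)"
    using lmeasurable_frame_powr_ball[OF assms, of "-1" 0 1]
    by (intro measure_mono_fmeasurable) (auto simp: fmeasurableD inv_eq_frame_powr[OF assms])
  also have "\<dots> = q ^ CARD('n) * measure lebesgue ?B" using q by (intro measure_ball) simp
  finally have "contraction_ratio A \<le> q ^ CARD('n)"
    using V by (simp add: contraction_ratio_def divide_simps)
  also have "\<dots> < 1" using q by (simp add: power_less_one_iff)
  finally show "contraction_ratio A < 1" .
qed

lemma lmeasurable_inv_power_ball:
  assumes "eigenframe A e l"
  shows "(inv A ^^ j) ` ball a r \<in> lmeasurable"
  by (simp add: inv_power_eq_frame_powr[OF assms] lmeasurable_frame_powr_ball[OF assms])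

lemma measure_inv_power_ball_pos:
  assumes "eigenframe A e l" "r > 0"
  shows "measure lebesgue ((inv A ^^ j) ` ball a r) > 0"
  using contraction_ratio_bounds[OF assms(1)] assms(2)
  by (simp add: measure_inv_power_image[OF assms(1)] measure_ball_pos)

section \<open>Comparison of density points\<close>

text \<open>Passing to the missing proportion turns density into a quantity to be bounded from
  above. From right to left, positive measure comes from the limit at \<open>r = 1\<close>: a null
  set has all density quotients 0.\<close>

lemma density_point_sets_iff:
  assumes "eigenframe A e l"
  shows "E \<in> density_point_sets A \<longleftrightarrow> E \<in> sets lebesgue \<and>
    (\<forall>r>0. (\<lambda>j. measure lebesgue ((inv A ^^ j) ` ball 0 r - E) /
                measure lebesgue ((inv A ^^ j) ` ball 0 r)) \<longlonglongrightarrow> 0)"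
    (is "_ \<longleftrightarrow> _ \<and> (\<forall>r>0. ?f r \<longlonglongrightarrow> 0)")
proof (cases "E \<in> sets lebesgue")
  case E: True
  let ?g = "\<lambda>r j. measure lebesgue (E \<inter> (inv A ^^ j) ` ball 0 r) /
                measure lebesgue ((inv A ^^ j) ` ball 0 r)"
  have fg: "?g r j = 1 - ?f r j" if "r > 0" for r j
  proof -
    let ?S = "(inv A ^^ j) ` ball 0 r"
    have "?S \<inter> E \<in> lmeasurable" "?S - E \<in> lmeasurable"
      using lmeasurable_inv_power_ball[OF assms] E
      by (auto intro: fmeasurable_Int_fmeasurable fmeasurable_Diff)
    then have "measure lebesgue (?S \<inter> E \<union> (?S - E)) =
        measure lebesgue (?S \<inter> E) + measure lebesgue (?S - E)"
      by (intro measure_Union[unfolded infinity_ennreal_def] fmeasurableD fmeasurableD2) auto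
    then have "measure lebesgue ?S = measure lebesgue (?S \<inter> E) + measure lebesgue (?S - E)"
      by (simp only: Int_Diff_Un)
    then show ?thesis
      using measure_inv_power_ball_pos[OF assms that, of j 0] by (simp add: field_simps Int_commute)
  qed
  have lim: "?g r \<longlonglongrightarrow> 1 \<longleftrightarrow> ?f r \<longlonglongrightarrow> 0" if "r > 0" for r
  proof
    assume "?g r \<longlonglongrightarrow> 1"
    from tendsto_diff[OF tendsto_const[of 1] this] show "?f r \<longlonglongrightarrow> 0"
      by (simp add: fg[OF that])
  next
    assume "?f r \<longlonglongrightarrow> 0"
    from tendsto_diff[OF tendsto_const[of 1] this] show "?g r \<longlonglongrightarrow> 1"
      by (simp add: fg[OF that])
  qed
  have "emeasure lebesgue E > 0" if "?g 1 \<longlonglongrightarrow> 1"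
  proof (rule ccontr)
    assume "\<not> emeasure lebesgue E > 0"
    then have "E \<in> null_sets lebesgue" using E by auto
    then have "measure lebesgue (E \<inter> X) = 0" if "X \<in> sets lebesgue" for X
      using that by (intro measure_eq_0_null_sets null_set_Int2)
    then have "?g 1 = (\<lambda>_. 0)"
      using lmeasurable_inv_power_ball[OF assms] by (auto simp: fmeasurableD)
    with that LIMSEQ_unique[OF tendsto_const[of 0]] show False by fastforce
  qed
  then show ?thesis
    using E lim unfolding density_point_sets_def by (auto intro: zero_less_one)
qed (auto simp: density_point_sets_def)

lemma density_point_sets_powr_subset:
  assumes A: "eigenframe A e l" and B: "eigenframe (frame_powr e l t) e' l'" and t: "t > 0"
  shows "density_point_sets A \<subseteq> density_point_sets (frame_powr e l t)"
proof
  let ?B = "frame_powr e l t"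
  let ?\<delta> = "contraction_ratio A"
  note \<delta> = contraction_ratio_bounds[OF A]
  have pow: "inv ?B ^^ j = frame_powr e l (- (t * real j))" for j
    by (simp add: inv_frame_powr[OF A] funpow_frame_powr[OF A])
  fix E assume "E \<in> density_point_sets A"
  then have E: "E \<in> sets lebesgue" and lim: "\<And>r. r > 0 \<Longrightarrow>
      (\<lambda>j. measure lebesgue ((inv A ^^ j) ` ball 0 r - E) /
           measure lebesgue ((inv A ^^ j) ` ball 0 r)) \<longlonglongrightarrow> 0"
    by (auto simp: density_point_sets_iff[OF A])
  have "(\<lambda>j. measure lebesgue ((inv ?B ^^ j) ` ball 0 r - E) /
             measure lebesgue ((inv ?B ^^ j) ` ball 0 r)) \<longlonglongrightarrow> 0" (is "?h \<longlonglongrightarrow> 0") if r: "r > 0" for r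
  proof -
    \<comment> \<open>Rounding down places the \<open>j\<close>-th ellipsoid of \<open>?B\<close>
      between those of \<open>A\<close> with indices \<open>k j\<close> and
      \<open>Suc (k j)\<close>.\<close>
    define k where "k j = nat \<lfloor>t * real j\<rfloor>" for j :: nat
    let ?g = "\<lambda>j. measure lebesgue ((inv A ^^ j) ` ball 0 r - E) / measure lebesgue ((inv A ^^ j) ` ball 0 r)"
    have k: "real (k j) \<le> t * real j" "t * real j \<le> real (Suc (k j))" for j
      using t real_of_int_floor_add_one_ge[of "t * real j"] unfolding k_def
      by (simp_all add: add.commute)
    have "filterlim (\<lambda>j. t * real j) at_top sequentially"
      using t by real_asymp
    then have "filterlim (\<lambda>j. \<lfloor>t * real j\<rfloor>) at_top sequentially"
      by (rule filterlim_compose[OF filterlim_floor_sequentially])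
    then have "filterlim k at_top sequentially"
      unfolding k_def by (rule filterlim_compose[OF filterlim_nat_sequentially])
    then have "(\<lambda>j. ?g (k j)) \<longlonglongrightarrow> 0"
      using filterlim_compose[OF lim[OF r]] by blast
    then have lim0: "(\<lambda>j. ?g (k j) / ?\<delta>) \<longlonglongrightarrow> 0"
      using tendsto_divide_zero by blast
    \<comment> \<open>The outer ellipsoid bounds the missing volume, the inner one the denominator;
      their volumes differ by the factor \<open>?\<delta>\<close>, the whole loss.\<close>
    have "?h j \<le> ?g (k j) / ?\<delta>" for j
    proof -
      let ?S = "(inv ?B ^^ j) ` ball 0 r" and ?T = "\<lambda>i. (inv A ^^ i) ` ball 0 r"
      have sub: "?S \<subseteq> ?T (k j)" "?T (Suc (k j)) \<subseteq> ?S"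
        unfolding pow inv_power_eq_frame_powr[OF A]
        using k[of j] by (auto intro!: frame_powr_ball_subset[OF A] simp del: of_nat_Suc)
      have Sm: "?S \<in> lmeasurable" by (simp add: pow lmeasurable_frame_powr_ball[OF A])
      have "measure lebesgue (?S - E) \<le> measure lebesgue (?T (k j) - E)"
        using sub Sm lmeasurable_inv_power_ball[OF A] E
        by (intro measure_mono_fmeasurable) (auto simp: fmeasurableD intro: fmeasurable.Diff fmeasurable_Diff)
      moreover have "?\<delta> * measure lebesgue (?T (k j)) \<le> measure lebesgue ?S"
      proof -
        have "measure lebesgue (?T (Suc (k j))) \<le> measure lebesgue ?S"
          using sub Sm lmeasurable_inv_power_ball[OF A]
          by (intro measure_mono_fmeasurable) (auto simp: fmeasurableD simp del: funpow.simps)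
        then show ?thesis
          by (simp add: measure_inv_power_image[OF A] mult_ac del: funpow.simps)
      qed
      moreover have "0 < ?\<delta> * measure lebesgue (?T (k j))"
        using \<delta> measure_inv_power_ball_pos[OF A r] by simp
      ultimately have "?h j \<le> measure lebesgue (?T (k j) - E) / (?\<delta> * measure lebesgue (?T (k j)))"
        by (intro frac_le) auto
      then show ?thesis by (simp add: mult.commute)
    qed
    then show ?thesis
      by (intro tendsto_sandwich[OF _ _ tendsto_const lim0]) (auto intro!: always_eventually)
  qed
  then show "E \<in> density_point_sets ?B"
    using E by (simp add: density_point_sets_iff[OF B])
qed

text \<open>In terms of \<open>t = ln (contraction_ratio B) / ln (contraction_ratio A)\<close> the
  claim reads \<open>l i powr t \<le> m j\<close>. As products of logarithms, the two sides swap
  when \<open>A\<close> and \<open>B\<close> do, so the reverse inclusion gives equality.\<close>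

lemma density_point_sets_subset_imp_ln_le:
  fixes A B :: "real ^ 'n \<Rightarrow> real ^ 'n"
  assumes A: "eigenframe A e l" and B: "eigenframe B f m"
    and sub: "density_point_sets A \<subseteq> density_point_sets B"
    and ne: "e i \<bullet> f j \<noteq> 0"
  shows "ln (l i) * - ln (contraction_ratio B) \<le> ln (m j) * - ln (contraction_ratio A)"
proof (rule ccontr)
  let ?a = "contraction_ratio A" and ?b = "contraction_ratio B"
  note ab = contraction_ratio_bounds[OF A] contraction_ratio_bounds[OF B]
  assume "\<not> ?thesis"
  then have less: "ln (m j) * - ln ?a < ln (l i) * - ln ?b" by simp
  define V where "V = measure lebesgue (ball (0 :: real ^ 'n) 1)"
  have V: "V > 0" by (simp add: V_def measure_ball_pos)
  have lm: "l i > 1" "m j > 1" using A B by (simp_all add: eigenframe_def)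
  have norm1: "norm (e i) = 1" "norm (f j) = 1"
    using A B by (simp_all add: eigenframe_def norm_eq_1)
  define c where "c = \<bar>e i \<bullet> f j\<bar>"
  have c: "c > 0" using ne by (simp add: c_def)
  \<comment> \<open>By self-adjointness, \<open>y \<bullet> a n\<close> is the
    \<open>e i\<close>-coordinate of the image of \<open>y\<close> under \<open>inv B ^^ n\<close>;
    thus \<open>norm (a n)\<close> is the half-width of the \<open>n\<close>-th ellipsoid in that
    direction.\<close>
  define a where "a n = frame_powr f m (- real n) (e i)" for n :: nat
  have norm_a: "m j powr (- real n) * c \<le> norm (a n)" for n
  proof -
    have "a n \<bullet> f j = m j powr (- real n) * (e i \<bullet> f j)"
      by (simp add: a_def inner_frame_powr[OF B])
    moreover have "\<bar>a n \<bullet> f j\<bar> \<le> norm (a n)"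
      using Cauchy_Schwarz_ineq2[of "a n" "f j"] norm1 by simp
    ultimately show ?thesis by (simp add: c_def abs_mult)
  qed
  have a_pos: "norm (a n) > 0" for n
    using norm_a[of n] c lm by (smt (verit) mult_pos_pos powr_gt_zero)
  define u where "u n = a n /\<^sub>R norm (a n)" for n
  \<comment> \<open>This small ball lies in the unit ball, fills a fixed proportion of it, and all
    its points satisfy \<open>y \<bullet> u n \<ge> 1/4\<close>; so \<open>G n\<close> lies far out
    in the direction \<open>e i\<close>.\<close>
  define G where "G n = (inv B ^^ n) ` ball (u n /\<^sub>R 2) (1/4)" for n
  define E where "E = - (\<Union>n. G n)"
  have norm_u: "norm (u n) = 1" for n
    using a_pos[of n] by (simp add: u_def)
  have ball_sub: "ball (u n /\<^sub>R 2) (1/4) \<subseteq> ball 0 1" for n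
  proof
    fix y assume "y \<in> ball (u n /\<^sub>R 2) (1/4)"
    then have "norm (y - u n /\<^sub>R 2) < 1/4" by (simp add: dist_norm norm_minus_commute)
    moreover have "norm y \<le> norm (y - u n /\<^sub>R 2) + norm (u n /\<^sub>R 2)"
      using norm_triangle_ineq[of "y - u n /\<^sub>R 2" "u n /\<^sub>R 2"] by simp
    ultimately show "y \<in> ball 0 1" using norm_u[of n] by simp
  qed
  have openG: "open (G n)" for n
    by (simp add: G_def inv_power_eq_frame_powr[OF B] open_frame_powr_image[OF B])
  then have E_meas: "E \<in> sets lebesgue"
    unfolding E_def by (intro lebesgue_closedin[of UNIV, simplified] closed_Compl[simplified]) auto
  have G_sub: "G n \<subseteq> (inv B ^^ n) ` ball 0 1" for n
    unfolding G_def using ball_sub by (intro image_mono)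
  have G_inner: "m j powr (- real n) * c / 4 \<le> x \<bullet> e i" if "x \<in> G n" for x n
  proof -
    obtain y where y: "norm (y - u n /\<^sub>R 2) < 1/4" "x = frame_powr f m (- real n) y"
      using \<open>x \<in> G n\<close>
      by (auto simp: G_def inv_power_eq_frame_powr[OF B] dist_norm norm_minus_commute)
    have "\<bar>(y - u n /\<^sub>R 2) \<bullet> u n\<bar> \<le> 1/4"
      using Cauchy_Schwarz_ineq2[of "y - u n /\<^sub>R 2" "u n"] norm_u[of n] y(1) by simp
    moreover have "(y - u n /\<^sub>R 2) \<bullet> u n = y \<bullet> u n - 1/2"
      using norm_u[of n] by (simp add: inner_diff_left norm_eq_1)
    ultimately have "1/4 \<le> y \<bullet> u n" by linarith
    then have "norm (a n) * (1/4) \<le> norm (a n) * (y \<bullet> u n)"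
      by (intro mult_left_mono) auto
    also have "\<dots> = x \<bullet> e i"
      using a_pos[of n] by (simp add: u_def y(2) frame_powr_self_adjoint[OF B] a_def)
    finally show ?thesis using norm_a[of n] by linarith
  qed
  have A_inner: "x \<bullet> e i \<le> r * l i powr (- real k)" if "x \<in> (inv A ^^ k) ` ball 0 r" for x r k
  proof -
    obtain y where y: "norm y < r" "x = frame_powr e l (- real k) y"
      using \<open>x \<in> (inv A ^^ k) ` ball 0 r\<close> by (auto simp: inv_power_eq_frame_powr[OF A])
    have "y \<bullet> e i \<le> r"
      using Cauchy_Schwarz_ineq2[of y "e i"] norm1 y(1) by simp
    then show ?thesis
      by (simp add: y(2) inner_frame_powr[OF A] mult.commute mult_right_mono)
  qed
  \<comment> \<open>chosen so that the volume factor of \<open>inv B\<close> is \<open>m j powr (- p)\<close>\<close>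
  define p where "p = - ln ?b / ln (m j)"
  have p: "p > 0" using ab lm by (simp add: p_def divide_neg_pos)
  \<comment> \<open>\<open>\<rho>\<close> is \<open>l i powr (- p)\<close> divided by the volume
    factor of \<open>inv A\<close>; the negated claim says exactly that it is below 1.\<close>
  define \<rho> where "\<rho> = exp (- ln ?a - p * ln (l i))"
  have pm: "- ln ?b = p * ln (m j)" using lm by (simp add: p_def)
  have "ln (m j) * - ln ?a < ln (m j) * (p * ln (l i))"
    using less unfolding pm by (simp only: mult_ac)
  then have "- ln ?a < p * ln (l i)"
    using ln_gt_zero[OF lm(2)] by (simp only: mult_less_cancel_left_pos)
  then have "- ln ?a - p * ln (l i) < 0" by linarith
  then have \<rho>: "0 < \<rho>" "\<rho> < 1"
    unfolding \<rho>_def by (simp_all only: exp_gt_zero exp_less_one_iff)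
  have "E \<in> density_point_sets A"
    unfolding density_point_sets_iff[OF A]
  proof (intro conjI allI impI E_meas)
    fix r :: real assume r: "r > 0"
    let ?S = "\<lambda>k. (inv A ^^ k) ` ball 0 r"
    define K where "K = (4 * r / c) powr p / r ^ CARD('n)"
    have bound: "measure lebesgue (?S k - E) \<le> V * (4 * r / c * l i powr (- real k)) powr p" for k
    \<comment> \<open>If no index satisfies this, \<open>?S k\<close> is too thin in the direction
      \<open>e i\<close> to meet any \<open>G n\<close>.\<close>
    proof (cases "\<exists>n. m j powr (- real n) * c / 4 \<le> r * l i powr (- real k)")
      case False
      have "x \<in> E" if x: "x \<in> ?S k" for x
      proof (rule ccontr)
        assume "x \<notin> E"
        then obtain n where "x \<in> G n" by (auto simp: E_def)
        with False A_inner[OF x] G_inner[of x n] show False by (metis order_trans)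
      qed
      then have empty: "?S k - E = {}" by blast
      show ?thesis using V unfolding empty by simp
    next
      case True
      \<comment> \<open>The ellipsoids containing the \<open>G n\<close> are nested, so the one with
        the least admissible index covers all of \<open>?S k - E\<close>.\<close>
      define N where "N = (LEAST n. m j powr (- real n) * c / 4 \<le> r * l i powr (- real k))"
      have N: "m j powr (- real N) * c / 4 \<le> r * l i powr (- real k)"
        unfolding N_def using True by (rule LeastI_ex)
      have "?S k - E \<subseteq> (inv B ^^ N) ` ball 0 1"
      proof
        fix x assume x: "x \<in> ?S k - E"
        then obtain n where n: "x \<in> G n" by (auto simp: E_def)
        have "m j powr (- real n) * c / 4 \<le> r * l i powr (- real k)"
          using G_inner[OF n] A_inner[of x k r] x by auto
        then have "N \<le> n" unfolding N_def by (rule Least_le)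
        then have "(inv B ^^ n) ` ball 0 1 \<subseteq> (inv B ^^ N) ` ball 0 1"
          unfolding inv_power_eq_frame_powr[OF B] by (intro frame_powr_ball_subset[OF B]) simp
        then show "x \<in> (inv B ^^ N) ` ball 0 1" using n G_sub by blast
      qed
      then have "measure lebesgue (?S k - E) \<le> measure lebesgue ((inv B ^^ N) ` ball 0 1)"
        using lmeasurable_inv_power_ball[OF A] lmeasurable_inv_power_ball[OF B] E_meas
        by (intro measure_mono_fmeasurable) (auto simp: fmeasurableD)
      also have "\<dots> = V * ?b ^ N"
        by (simp add: measure_inv_power_image[OF B] V_def mult.commute)
      \<comment> \<open>The choice of \<open>p\<close> turns volume into a power of thickness, to
        which the bound on \<open>N\<close> applies.\<close>
      also have "?b ^ N = (m j powr (- real N)) powr p"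
      proof -
        have "(m j powr (- real N)) powr p = exp (real N * ln ?b)"
          using lm by (simp add: powr_def p_def)
        then show ?thesis using ab by (simp add: exp_of_nat_mult)
      qed
      also have "V * \<dots> \<le> V * (4 * r / c * l i powr (- real k)) powr p"
        using N c V p by (intro mult_left_mono powr_mono2) (auto simp: field_simps)
      finally show ?thesis .
    qed
    have ratio: "measure lebesgue (?S k - E) / measure lebesgue (?S k) \<le> K * \<rho> ^ k" for k
    proof -
      have S: "measure lebesgue (?S k) = exp (real k * ln ?a) * (r ^ CARD('n) * V)"
      proof -
        have "exp (real k * ln ?a) = ?a ^ k" using ab by (simp add: exp_of_nat_mult)
        moreover have "measure lebesgue (ball (0 :: real ^ 'n) r) = r ^ CARD('n) * V"
          unfolding V_def using r by (intro measure_ball) simp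
        ultimately show ?thesis by (simp only: measure_inv_power_image[OF A open_ball])
      qed
      have "(4 * r / c * l i powr (- real k)) powr p = (4 * r / c) powr p * (l i powr (- real k)) powr p"
        by (rule powr_mult)
      also have "(l i powr (- real k)) powr p = \<rho> ^ k * exp (real k * ln ?a)"
        using lm by (simp add: powr_def \<rho>_def flip: exp_of_nat_mult exp_add) (simp add: algebra_simps)
      finally have eq: "(4 * r / c * l i powr (- real k)) powr p =
          (4 * r / c) powr p * (\<rho> ^ k * exp (real k * ln ?a))" .
      have "measure lebesgue (?S k - E) / measure lebesgue (?S k) \<le>
          V * (4 * r / c * l i powr (- real k)) powr p / measure lebesgue (?S k)"
        using bound by (intro divide_right_mono) auto
      also have "\<dots> = K * \<rho> ^ k"
        unfolding eq S K_def using V by simp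
      finally show ?thesis .
    qed
    show "(\<lambda>k. measure lebesgue (?S k - E) / measure lebesgue (?S k)) \<longlonglongrightarrow> 0"
    proof (rule tendsto_sandwich[OF _ _ tendsto_const])
      show "\<forall>\<^sub>F k in sequentially. 0 \<le> measure lebesgue (?S k - E) / measure lebesgue (?S k)"
        by (intro always_eventually allI divide_nonneg_nonneg measure_nonneg)
      show "\<forall>\<^sub>F k in sequentially. measure lebesgue (?S k - E) / measure lebesgue (?S k) \<le> K * \<rho> ^ k"
        by (intro always_eventually allI ratio)
      show "(\<lambda>k. K * \<rho> ^ k) \<longlonglongrightarrow> 0"
        using \<rho> by (intro tendsto_mult_right_zero LIMSEQ_realpow_zero) auto
    qed
  qed
  then have "E \<in> density_point_sets B" using sub by blast
  then have lim: "(\<lambda>n. measure lebesgue ((inv B ^^ n) ` ball 0 1 - E) /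
                measure lebesgue ((inv B ^^ n) ` ball 0 1)) \<longlonglongrightarrow> 0"
    by (simp add: density_point_sets_iff[OF B])
  \<comment> \<open>Each \<open>G n\<close> by itself removes this proportion from the
    \<open>n\<close>-th ellipsoid of \<open>B\<close>, so \<open>E\<close> cannot have density 1
    along \<open>B\<close>.\<close>
  have "(1/4) ^ CARD('n) \<le> measure lebesgue ((inv B ^^ n) ` ball 0 1 - E) /
                measure lebesgue ((inv B ^^ n) ` ball 0 1)" for n
  proof -
    have "?b ^ n * ((1/4) ^ CARD('n) * V) = measure lebesgue (G n)"
      using measure_ball[of "1/4" "u n /\<^sub>R 2"]
      by (simp add: G_def measure_inv_power_image[OF B] V_def)
    also have "\<dots> \<le> measure lebesgue ((inv B ^^ n) ` ball 0 1 - E)"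
      using G_sub[of n] openG[of n] lmeasurable_inv_power_ball[OF B] E_meas
      by (intro measure_mono_fmeasurable fmeasurable_Diff) (auto simp: E_def fmeasurableD)
    finally show ?thesis
      using V ab by (simp add: measure_inv_power_image[OF B] V_def field_simps)
  qed
  then have "(1/4 :: real) ^ CARD('n) \<le> 0"
    by (intro LIMSEQ_le_const[OF lim]) auto
  moreover have "(0 :: real) < (1/4) ^ CARD('n)" by (rule zero_less_power) simp
  ultimately show False by linarith
qed

section \<open>The two implications of the equivalence\<close>

theorem theorem16:
  fixes A1 A2 :: "real ^ 'n \<Rightarrow> real ^ 'n"
  assumes "positive_map A1" and "expansive_map A1"
    and "positive_map A2" and "expansive_map A2"
  shows "density_point_sets A1 = density_point_sets A2 \<longleftrightarrow> (\<exists>t>0. powr_map A1 t = A2)"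
proof -
  obtain e l where A1: "eigenframe A1 e l"
    using positive_expansive_eigenframe assms by blast
  obtain f m where A2: "eigenframe A2 f m"
    using positive_expansive_eigenframe assms by blast
  have powr: "powr_map A1 t = frame_powr e l t" for t
    by (rule powr_map_eq) (rule is_powr_map_frame_powr[OF A1])
  show ?thesis
  proof
    assume "\<exists>t>0. powr_map A1 t = A2"
    then obtain t where t: "t > 0" and A2_eq: "A2 = frame_powr e l t" unfolding powr by blast
    define k where "k i = l i powr t" for i
    have frame: "eigenframe A2 e k"
      using A1 t unfolding eigenframe_def k_def A2_eq
      by (auto simp: linear_frame_powr frame_powr_eigen[OF A1])
    have "l i > 0" for i using A1 by (auto simp: eigenframe_def intro: less_trans[of 0 1])
    \<comment> \<open>\<open>A1\<close> is in turn the power \<open>1 / t\<close> of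
      \<open>A2\<close> in the same frame, so one inclusion lemma serves both directions.\<close>
    then have "frame_powr e k (1 / t) = frame_powr e l 1"
      using t by (intro ext) (simp add: frame_powr_def k_def powr_powr)
    then have A1_eq: "A1 = frame_powr e k (1 / t)" by (simp add: frame_powr_1[OF A1])
    have "density_point_sets A1 \<subseteq> density_point_sets A2"
      using density_point_sets_powr_subset[OF A1 _ t] frame unfolding A2_eq by blast
    moreover have "density_point_sets A2 \<subseteq> density_point_sets A1"
      using density_point_sets_powr_subset[OF frame, of "1 / t"] A1 t unfolding A1_eq[symmetric] by simp
    ultimately show "density_point_sets A1 = density_point_sets A2" by blast
  next
    assume eq: "density_point_sets A1 = density_point_sets A2"
    \<comment> \<open>The exponent is forced by volume: a power \<open>t\<close> of
      \<open>A1\<close> has contraction ratio \<open>contraction_ratio A1 powr t\<close>.\<close>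
    define t where "t = ln (contraction_ratio A2) / ln (contraction_ratio A1)"
    note ratio = contraction_ratio_bounds[OF A1] contraction_ratio_bounds[OF A2]
    have t: "t > 0" using ratio by (simp add: t_def divide_neg_neg)
    have powr_eq: "m j = l i powr t" if "e i \<bullet> f j \<noteq> 0" for i j
    proof -
      have "ln (l i) * - ln (contraction_ratio A2) = ln (m j) * - ln (contraction_ratio A1)"
        using density_point_sets_subset_imp_ln_le[OF A1 A2, of i j]
          density_point_sets_subset_imp_ln_le[OF A2 A1, of j i] eq that
        by (simp add: inner_commute)
      then have "ln (m j) = t * ln (l i)"
        using ratio by (simp add: t_def field_simps)
      then have "exp (ln (m j)) = exp (t * ln (l i))" by simp
      moreover have "l i > 1" "m j > 1" using A1 A2 by (simp_all add: eigenframe_def)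
      ultimately show ?thesis by (simp add: powr_def)
    qed
    \<comment> \<open>Coordinates are compared in the frame \<open>f\<close>: each coordinate of
      \<open>e i\<close> either vanishes or belongs to an eigenvalue
      \<open>m j = l i powr t\<close>.\<close>
    have A2_e: "A2 (e i) = l i powr t *\<^sub>R e i" for i
    proof (rule frame_eqI[OF A2])
      fix j
      have "A2 (e i) \<bullet> f j = m j * (e i \<bullet> f j)"
      proof -
        have "m j > 1" using A2 by (simp add: eigenframe_def)
        then show ?thesis
          using inner_frame_powr[OF A2, of 1 "e i" j] by (simp add: frame_powr_1[OF A2])
      qed
      then show "A2 (e i) \<bullet> f j = (l i powr t *\<^sub>R e i) \<bullet> f j"
        using powr_eq[of i j] by (cases "e i \<bullet> f j = 0") auto
    qed
    have "A2 x = frame_powr e l t x" for x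
    proof -
      have lin: "linear A2" using A2 by (simp add: eigenframe_def)
      have "A2 x = A2 (\<Sum>i\<in>UNIV. (x \<bullet> e i) *\<^sub>R e i)" by (simp add: frame_expansion[OF A1])
      also have "\<dots> = frame_powr e l t x"
        by (simp add: linear_sum[OF lin] linear_cmul[OF lin] A2_e frame_powr_def mult.commute)
      finally show ?thesis .
    qed
    then have "powr_map A1 t = A2" by (auto simp: powr)
    with t show "\<exists>t>0. powr_map A1 t = A2" by blast
  qed
qed

end
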